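(* The following hold. (1) For every positive integer $s$ and prime $p$: $$\sum_{k=1}^{s}Q_{pk}[p]=2s-\left\lfloor\frac sp\right\rfloor,\qquad \prod_{k=1}^{s}Q_{pk}[p]=2^{\,s-\lfloor s/p\rfloor}.$$ (2) For every prime $m$ and positive integer $k$: $$\sum_{x\mid m^k}Q_{m^k}[x]=2k+1,\qquad \prod_{x\mid m^k}Q_{m^k}[x]=k+1.$$ (3) For every integer $k\ge0$, prime $p$ and positive integer $t$ with $\gcd(t,p)=1$: $$\sum_{r=0}^{k}Q_{t p^{r}}[p^{r}]=\sum_{n=1}^{k+1}n=\binom{k+2}{2},\qquad \prod_{r=0}^{k}Q_{t p^{r}}[p^{r}]=\prod_{n=1}^{k+1}n=(k+1)!.$$ (4) For every prime $p$ and integer $k\ge0$: $$\sum_{b\mid p^{k}}\frac{\tau(b)}{Q_{p^{k}}[b]}=\binom{k+1}{2}+1,\qquad \prod_{b\mid p^{k}}\frac{\tau(b)}{Q_{p^{k}}[b]}=k!.$$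
   Context: For positive integers $a,b$, $Q_a[b]$ denotes the number of positive integers $x$ with $\operatorname{lcm}(x,b)=a$. $\tau(n)$ is the number of positive divisors of $n$. Sums and products over $x\mid N$ run over positive divisors of $N$. *)

theory Defs
  imports Complex_Main "HOL-Computational_Algebra.Primes"
begin

definition Q :: "nat \<Rightarrow> nat \<Rightarrow> nat" where
  "Q a b = card {x. x > 0 \<and> lcm x b = a}"

definition tau :: "nat \<Rightarrow> nat" where
  "tau n = card {d. d > 0 \<and> d dvd n}"

end

theory Submission
  imports Defs
begin

text \<open>
  Everything reduces to one count. Let \<open>t > 0\<close> be prime to \<open>p\<close> and \<open>i \<le> n\<close>. Taking the lcm with \<open>p ^ i\<close>
  affects only the \<open>p\<close>-part of \<open>x\<close>, replacing its exponent \<open>j\<close> by \<open>max j i\<close>; so \<open>lcm x (p ^ i) = t * p ^ n\<close>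
  forces \<open>x = t * p ^ j\<close> with \<open>max j i = n\<close>. For \<open>i < n\<close> the only choice is \<open>j = n\<close>, whereas for
  \<open>i = n\<close> every \<open>j \<le> n\<close> works. Hence the count is \<open>1\<close> or \<open>n + 1\<close> respectively
  (\<open>Q_prime_power\<close>).

  The first part then has summand \<open>1\<close> when \<open>p dvd k\<close> and \<open>2\<close> otherwise, so only the number
  \<open>s div p\<close> of multiples of \<open>p\<close> up to \<open>s\<close> matters. In the second and fourth part the divisors of the prime
  power are indexed by their exponent \<open>i \<le> k\<close>, and the top exponent \<open>i = k\<close> is the only exceptional
  one. In the third part every term is of the exceptional kind and equals \<open>r + 1\<close>.
\<close>

section \<open>Solving the lcm equation at a prime power\<close>

lemma lcm_times_coprime_power:
  fixes p u :: nat
  assumes "coprime u p"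
  shows "lcm (u * p ^ j) (p ^ i) = u * p ^ max j i"
proof (cases "j \<le> i")
  case True
  define d where "d = i - j"
  have i: "i = j + d" using True by (simp add: d_def)
  have "lcm (u * p ^ j) (p ^ i) = lcm (p ^ j * u) (p ^ j * p ^ d)"
    by (simp only: i power_add mult.commute)
  also have "\<dots> = p ^ j * lcm u (p ^ d)"
    by (simp only: lcm_mult_left normalize_nat_def id_apply)
  also have "lcm u (p ^ d) = u * p ^ d"
    using assms by (simp add: lcm_coprime)
  finally show ?thesis
    by (simp add: i power_add)
next
  case False
  then have "p ^ i dvd u * p ^ j"
    by (simp add: le_imp_power_dvd)
  with False show ?thesis
    by (simp add: lcm_proj1_if_dvd)
qed

lemma times_prime_power_unique:
  fixes p t u :: nat
  assumes p: "prime p" and u: "coprime u p" "u > 0" and t: "coprime t p" "t > 0"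
    and eq: "u * p ^ m = t * p ^ n"
  shows "u = t \<and> m = n"
proof -
  have mult: "multiplicity p (v * p ^ l) = l" if "coprime v p" "v > 0" for v l
  proof (rule multiplicity_eqI)
    show "\<not> p ^ Suc l dvd v * p ^ l"
      using that p by (auto simp: coprime_absorb_right not_prime_unit dest: prime_gt_0_nat)
  qed simp
  from mult[OF u, of m] mult[OF t, of n] eq have "m = n"
    by simp
  with eq p show ?thesis
    by (simp add: prime_gt_0_nat)
qed

lemma obtain_times_prime_power:
  fixes p x :: nat
  assumes "prime p" "x > 0"
  obtains u j where "x = u * p ^ j" "coprime u p" "u > 0"
proof -
  obtain u where "x = p ^ multiplicity p x * u" "\<not> p dvd u"
    using multiplicity_decompose'[of x p] assms not_prime_unit by blast
  then show thesis
    using assms that[of u "multiplicity p x"] prime_imp_coprime[of p u]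
    by (auto simp: mult_ac coprime_commute intro!: gr0I)
qed

text \<open>
  Write \<open>x = u * p ^ j\<close> with \<open>u\<close> prime to \<open>p\<close>. Both sides of the lcm equation then have the form
  "part prime to \<open>p\<close> times power of \<open>p\<close>", so uniqueness of that decomposition gives \<open>u = t\<close> and
  leaves a condition on \<open>j\<close> alone.
\<close>

lemma lcm_eq_times_prime_power_solutions:
  fixes p t :: nat
  assumes p: "prime p" and t: "coprime t p" "t > 0"
  shows "{x. x > 0 \<and> lcm x (p ^ i) = t * p ^ n} = (\<lambda>j. t * p ^ j) ` {j. max j i = n}"
proof (intro equalityI subsetI)
  fix x assume "x \<in> {x. x > 0 \<and> lcm x (p ^ i) = t * p ^ n}"
  then have x: "x > 0" "lcm x (p ^ i) = t * p ^ n" by auto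
  obtain u j where u: "x = u * p ^ j" "coprime u p" "u > 0"
    using obtain_times_prime_power[OF p x(1)] .
  then have "u * p ^ max j i = t * p ^ n"
    using x(2) lcm_times_coprime_power by simp
  then have "u = t \<and> max j i = n"
    using times_prime_power_unique[OF p u(2,3) t] by blast
  with u(1) show "x \<in> (\<lambda>j. t * p ^ j) ` {j. max j i = n}" by blast
next
  fix x assume "x \<in> (\<lambda>j. t * p ^ j) ` {j. max j i = n}"
  then show "x \<in> {x. x > 0 \<and> lcm x (p ^ i) = t * p ^ n}"
    using p t by (auto simp: lcm_times_coprime_power prime_gt_0_nat)
qed

lemma Q_prime_power:
  assumes p: "prime p" and t: "coprime t p" "t > 0" and "i \<le> n"
  shows "Q (t * p ^ n) (p ^ i) = (if i = n then n + 1 else 1)"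
proof -
  have "inj_on (\<lambda>j. t * p ^ j) {j. max j i = n}"
    using prime_gt_1_nat[OF p] t(2) by (simp add: inj_on_def)
  then have "Q (t * p ^ n) (p ^ i) = card {j. max j i = n}"
    unfolding Q_def lcm_eq_times_prime_power_solutions[OF p t] by (rule card_image)
  moreover have "{j. max j i = n} = (if i = n then {..n} else {n})"
    using \<open>i \<le> n\<close> by (auto simp: max_def)
  ultimately show ?thesis by simp
qed

section \<open>Multiples of a prime\<close>

lemma Q_prime_multiple:
  assumes p: "prime p" and "k > 0"
  shows "Q (p * k) p = (if p dvd k then 1 else 2)"
proof -
  obtain u j where u: "k = u * p ^ j" "coprime u p" "u > 0"
    using obtain_times_prime_power[OF assms] .
  have "p dvd k \<longleftrightarrow> j \<noteq> 0"
    using u p by (cases j) (auto simp: coprime_absorb_right not_prime_unit)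
  (* Multiplying by p makes the exponent at least 1, and it equals that of b = p exactly when p does
     not divide k; the exceptional value n + 1 is then 2. *)
  moreover have "Q (p * k) p = Q (u * p ^ (j + 1)) (p ^ 1)"
    by (simp add: u(1) mult_ac)
  ultimately show ?thesis
    using Q_prime_power[OF p u(2,3), of 1 "j + 1"] by simp
qed

lemma card_multiples:
  fixes p s :: nat
  assumes "p > 0"
  shows "card ({1..s} \<inter> {k. p dvd k}) = s div p"
proof -
  have "{1..s} \<inter> {k. p dvd k} = (*) p ` {1..s div p}"
  proof (intro equalityI subsetI)
    fix k assume k: "k \<in> {1..s} \<inter> {k. p dvd k}"
    then have "k div p > 0"
      using assms by (simp add: div_greater_zero_iff dvd_imp_le)
    with k have "k div p \<in> {1..s div p}"
      by (simp add: div_le_mono)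
    moreover have "k = p * (k div p)" using k by simp
    ultimately show "k \<in> (*) p ` {1..s div p}" by (rule rev_image_eqI)
  next
    fix k assume "k \<in> (*) p ` {1..s div p}"
    then show "k \<in> {1..s} \<inter> {k. p dvd k}"
      using assms by (auto simp: less_eq_div_iff_mult_less_eq mult.commute Suc_le_eq)
  qed
  moreover have "inj_on ((*) p) {1..s div p}"
    using assms by (simp add: inj_on_def)
  ultimately show ?thesis
    by (simp add: card_image)
qed

lemma card_nonmultiples:
  fixes p s :: nat
  assumes "p > 0"
  shows "card ({1..s} \<inter> {k. \<not> p dvd k}) = s - s div p"
proof -
  have "{1..s} \<inter> {k. \<not> p dvd k} = {1..s} - ({1..s} \<inter> {k. p dvd k})" by auto
  then show ?thesis
    using card_multiples[OF assms, of s] card_Diff_subset[of "{1..s} \<inter> {k. p dvd k}" "{1..s}"]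
    by simp
qed

lemma sum_prod_Q_prime_multiples:
  assumes p: "prime p"
  shows "(\<Sum>k=1..s. Q (p * k) p) = 2 * s - s div p"
    and "(\<Prod>k=1..s. Q (p * k) p) = 2 ^ (s - s div p)"
proof -
  have p0: "p > 0" using p by (rule prime_gt_0_nat)
  have Qk: "Q (p * k) p = (if p dvd k then 1 else 2)" if "k \<in> {1..s}" for k
    using that by (intro Q_prime_multiple p) auto
  have neg: "- {k. p dvd k} = {k. \<not> p dvd k}" by auto
  have "(\<Sum>k=1..s. Q (p * k) p) = (\<Sum>k=1..s. if p dvd k then 1 else 2)"
    by (intro sum.cong refl Qk)
  also have "\<dots> = s div p + 2 * (s - s div p)"
    using card_multiples[OF p0, of s] card_nonmultiples[OF p0, of s]
    by (simp add: sum.If_cases neg)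
  also have "\<dots> = 2 * s - s div p"
    using div_le_dividend[of s p] by linarith
  finally show "(\<Sum>k=1..s. Q (p * k) p) = 2 * s - s div p" .
  have "(\<Prod>k=1..s. Q (p * k) p) = (\<Prod>k=1..s. if p dvd k then 1 else 2)"
    by (intro prod.cong refl Qk)
  also have "\<dots> = 2 ^ (s - s div p)"
    using card_nonmultiples[OF p0, of s]
    by (simp add: prod.If_cases neg)
  finally show "(\<Prod>k=1..s. Q (p * k) p) = 2 ^ (s - s div p)" .
qed

section \<open>Divisors of a prime power\<close>

lemma bij_betw_prime_power_divisors:
  fixes p :: nat
  assumes p: "prime p"
  shows "bij_betw ((^) p) {..k} {x. x > 0 \<and> x dvd p ^ k}"
proof -
  have "{x. x > 0 \<and> x dvd p ^ k} = (^) p ` {..k}"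
    using p by (auto simp: divides_primepow_nat le_imp_power_dvd prime_gt_0_nat)
  moreover have "inj_on ((^) p) {..k}"
    using prime_gt_1_nat[OF p] by (simp add: inj_on_def)
  ultimately show ?thesis by (simp add: bij_betw_def)
qed

lemma tau_prime_power:
  assumes "prime p"
  shows "tau (p ^ i) = i + 1"
  using bij_betw_same_card[OF bij_betw_prime_power_divisors[OF assms, of i]]
  by (simp add: tau_def)

lemma Q_prime_power_divisor:
  assumes "prime p" "i \<le> k"
  shows "Q (p ^ k) (p ^ i) = (if i = k then k + 1 else 1)"
  using Q_prime_power[of p 1 i k] assms by simp

lemma sum_prod_Q_prime_power_divisors:
  assumes p: "prime p"
  shows "(\<Sum>x | x > 0 \<and> x dvd p ^ k. Q (p ^ k) x) = 2 * k + 1"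
    and "(\<Prod>x | x > 0 \<and> x dvd p ^ k. Q (p ^ k) x) = k + 1"
proof -
  note bij = bij_betw_prime_power_divisors[OF p, of k]
  show "(\<Sum>x | x > 0 \<and> x dvd p ^ k. Q (p ^ k) x) = 2 * k + 1"
    unfolding sum.reindex_bij_betw[OF bij, symmetric] lessThan_Suc_atMost[symmetric]
    using p by (simp add: Q_prime_power_divisor)
  show "(\<Prod>x | x > 0 \<and> x dvd p ^ k. Q (p ^ k) x) = k + 1"
    unfolding prod.reindex_bij_betw[OF bij, symmetric] lessThan_Suc_atMost[symmetric]
    using p by (simp add: Q_prime_power_divisor)
qed

lemma sum_Suc_eq_choose: "(\<Sum>i<k. i + 1) = (k + 1) choose 2"
  by (induction k) (simp_all add: numeral_2_eq_2)

text \<open>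
  For \<open>i < k\<close> the divisor \<open>p ^ i\<close> contributes \<open>\<tau>(p ^ i) = i + 1\<close>; at \<open>i = k\<close> numerator and
  denominator agree, so this term is \<open>1\<close>. It accounts for the summand \<open>+ 1\<close>, and for the product
  being \<open>k!\<close> rather than \<open>(k + 1)!\<close>.
\<close>

lemma sum_prod_tau_div_Q:
  assumes p: "prime p"
  shows "(\<Sum>b | b > 0 \<and> b dvd p ^ k. real (tau b) / real (Q (p ^ k) b))
           = real (((k + 1) choose 2) + 1)"
    and "(\<Prod>b | b > 0 \<and> b dvd p ^ k. real (tau b) / real (Q (p ^ k) b)) = fact k"
proof -
  note bij = bij_betw_prime_power_divisors[OF p, of k]
  have summand: "real (tau (p ^ i)) / real (Q (p ^ k) (p ^ i)) = (if i = k then 1 else real (i + 1))"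
    if "i \<le> k" for i
    using that p by (simp add: Q_prime_power_divisor tau_prime_power)
  have "(\<Sum>b | b > 0 \<and> b dvd p ^ k. real (tau b) / real (Q (p ^ k) b))
          = (\<Sum>i<k. real (i + 1)) + 1"
    unfolding sum.reindex_bij_betw[OF bij, symmetric] lessThan_Suc_atMost[symmetric]
    by (simp add: summand)
  also have "(\<Sum>i<k. real (i + 1)) = real ((k + 1) choose 2)"
    by (simp only: of_nat_sum[symmetric] sum_Suc_eq_choose)
  finally show "(\<Sum>b | b > 0 \<and> b dvd p ^ k. real (tau b) / real (Q (p ^ k) b))
           = real (((k + 1) choose 2) + 1)" by simp
  have "(\<Prod>b | b > 0 \<and> b dvd p ^ k. real (tau b) / real (Q (p ^ k) b)) = (\<Prod>i<k. real (i + 1))"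
    unfolding prod.reindex_bij_betw[OF bij, symmetric] lessThan_Suc_atMost[symmetric]
    by (simp add: summand)
  also have "\<dots> = fact k"
    by (simp add: fact_prod_Suc atLeast0LessThan)
  finally show "(\<Prod>b | b > 0 \<and> b dvd p ^ k. real (tau b) / real (Q (p ^ k) b)) = fact k" .
qed

section \<open>The sum and product identities\<close>

theorem corollary9p7:
  shows "(\<forall>s p :: nat. s > 0 \<longrightarrow> prime p \<longrightarrow>
            int (\<Sum>k=1..s. Q (p * k) p) = 2 * int s - \<lfloor>real s / real p\<rfloor> \<and>
            real (\<Prod>k=1..s. Q (p * k) p) = 2 powi (int s - \<lfloor>real s / real p\<rfloor>))
       \<and> (\<forall>m k :: nat. prime m \<longrightarrow> k > 0 \<longrightarrow>
            (\<Sum>x | x > 0 \<and> x dvd m ^ k. Q (m ^ k) x) = 2 * k + 1 \<and>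
            (\<Prod>x | x > 0 \<and> x dvd m ^ k. Q (m ^ k) x) = k + 1)
       \<and> (\<forall>k p t :: nat. prime p \<longrightarrow> t > 0 \<longrightarrow> gcd t p = 1 \<longrightarrow>
            (\<Sum>r=0..k. Q (t * p ^ r) (p ^ r)) = (\<Sum>n=1..k+1. n) \<and>
            (\<Sum>n=1..k+1. n) = (k + 2) choose 2 \<and>
            (\<Prod>r=0..k. Q (t * p ^ r) (p ^ r)) = (\<Prod>n=1..k+1. n) \<and>
            (\<Prod>n=1..k+1. n) = fact (k + 1))
       \<and> (\<forall>p k :: nat. prime p \<longrightarrow>
            (\<Sum>b | b > 0 \<and> b dvd p ^ k. real (tau b) / real (Q (p ^ k) b))
              = real (((k + 1) choose 2) + 1) \<and>
            (\<Prod>b | b > 0 \<and> b dvd p ^ k. real (tau b) / real (Q (p ^ k) b)) = fact k)"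
proof (intro conjI allI impI)
  fix s p :: nat assume p: "prime p"
  have fl: "\<lfloor>real s / real p\<rfloor> = int (s div p)"
    by (rule floor_divide_of_nat_eq)
  have le: "s div p \<le> s" by (rule div_le_dividend)
  show "int (\<Sum>k=1..s. Q (p * k) p) = 2 * int s - \<lfloor>real s / real p\<rfloor>"
    unfolding sum_prod_Q_prime_multiples(1)[OF p] fl using le by (simp only: of_nat_diff)
  have "int s - \<lfloor>real s / real p\<rfloor> = int (s - s div p)"
    unfolding fl using le by (simp only: of_nat_diff)
  then show "real (\<Prod>k=1..s. Q (p * k) p) = 2 powi (int s - \<lfloor>real s / real p\<rfloor>)"
    unfolding sum_prod_Q_prime_multiples(2)[OF p] by (simp only: power_int_of_nat) simp
next
  fix m k :: nat assume m: "prime m"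
  show "(\<Sum>x | x > 0 \<and> x dvd m ^ k. Q (m ^ k) x) = 2 * k + 1"
    and "(\<Prod>x | x > 0 \<and> x dvd m ^ k. Q (m ^ k) x) = k + 1"
    by (fact sum_prod_Q_prime_power_divisors[OF m])+
next
  fix k p t :: nat assume p: "prime p" and t: "t > 0" "gcd t p = 1"
  have Qr: "Q (t * p ^ r) (p ^ r) = Suc r" for r
    using Q_prime_power[OF p _ t(1), of r r] t(2) by (simp add: coprime_iff_gcd_eq_1)
  show "(\<Sum>r=0..k. Q (t * p ^ r) (p ^ r)) = (\<Sum>n=1..k+1. n)"
    unfolding Qr by (simp add: sum.shift_bounds_cl_Suc_ivl del: sum.cl_ivl_Suc)
  show "(\<Prod>r=0..k. Q (t * p ^ r) (p ^ r)) = (\<Prod>n=1..k+1. n)"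
    unfolding Qr by (simp add: prod.shift_bounds_cl_Suc_ivl del: prod.cl_ivl_Suc)
  show "(\<Sum>n=1..k+1. n) = (k + 2) choose 2"
    by (induction k) (simp_all add: numeral_2_eq_2)
  show "(\<Prod>n=1..k+1. n) = fact (k + 1)"
    by (simp only: fact_prod of_nat_id)
next
  fix p k :: nat assume p: "prime p"
  show "(\<Sum>b | b > 0 \<and> b dvd p ^ k. real (tau b) / real (Q (p ^ k) b))
              = real (((k + 1) choose 2) + 1)"
    and "(\<Prod>b | b > 0 \<and> b dvd p ^ k. real (tau b) / real (Q (p ^ k) b)) = fact k"
    by (fact sum_prod_tau_div_Q[OF p])+
qed

end
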